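(* Let $A=[a_{ij}]\in\mathbb{R}^{n\times n}$ be the coefficient matrix of a fuzzy linear system, and let $S=\begin{bmatrix} D & E\\ E & D\end{bmatrix}\in\mathbb{R}^{2n\times 2n}$ be its associated matrix, where $D=[\max(a_{ij},0)]$ and $E=[\max(-a_{ij},0)]$. Let $H,Z\in\mathbb{R}^{n\times n}$. Then the core-EP inverse $S^{\dagger_{c}}$ of $S$ is $$S^{\dagger_{c}}=\begin{bmatrix} H & Z\\ Z & H\end{bmatrix}$$ if and only if $$H=\tfrac12\left[(D+E)^{\dagger_{c}}+(D-E)^{\dagger_{c}}\right]\quad\text{and}\quad Z=\tfrac12\left[(D+E)^{\dagger_{c}}-(D-E)^{\dagger_{c}}\right].$$
   Context: For a real square matrix $M$, $M^{*}$ denotes its transpose, and $\mathrm{ind}(M)$ is the smallest nonnegative integer $k$ with $\operatorname{rank}(M^{k+1})=\operatorname{rank}(M^{k})$ (with $M^0=I$). For a real square matrix $M$ with $\mathrm{ind}(M)=k$, the core-EP inverse of $M$, denoted here $M^{\dagger_{c}}$, is the unique real matrix $X$ of the same size satisfying $XM^{k+1}=M^{k}$, $MX^{2}=X$ and $(MX)^{*}=MX$; it exists for every square matrix. A fuzzy linear system is a system $A\tilde X=\tilde Y$ with $A=[a_{ij}]$ a real $n\times n$ matrix and $\tilde X,\tilde Y$ vectors of fuzzy numbers; $A$ may be any real $n\times n$ matrix. Note that $A=D-E$ and $|A|=[|a_{ij}|]=D+E$. *)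

theory Defs
  imports "HOL-Analysis.Analysis"
begin

text \<open>
  On the type \<^typ>\<open>real^'n^'n\<close> the library's \<open>*\<close>, \<open>1\<close> and \<open>^\<close> act entrywise, so powers with
  respect to the matrix product \<open>**\<close> are defined separately.
\<close>

primrec matrix_power :: "real^'n^'n \<Rightarrow> nat \<Rightarrow> real^'n^'n" where
  "matrix_power M 0 = mat 1"
| "matrix_power M (Suc k) = M ** matrix_power M k"

definition matrix_index :: "real^'n^'n \<Rightarrow> nat" where
  "matrix_index M = (LEAST k. rank (matrix_power M (k + 1)) = rank (matrix_power M k))"

definition is_core_ep_inverse :: "real^'n^'n \<Rightarrow> real^'n^'n \<Rightarrow> bool" where
  "is_core_ep_inverse M X \<longleftrightarrow>
     X ** matrix_power M (matrix_index M + 1) = matrix_power M (matrix_index M) \<and>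
     M ** (X ** X) = X \<and>
     transpose (M ** X) = M ** X"

definition core_ep_inverse :: "real^'n^'n \<Rightarrow> real^'n^'n" where
  "core_ep_inverse M = (THE X. is_core_ep_inverse M X)"

text \<open>
  The block matrix with first block row \<open>P Q\<close> and second block row \<open>R T\<close>; the index type
  \<^typ>\<open>'n + 'n\<close> plays the role of \<open>{1..2n}\<close>, with \<^const>\<open>Inl\<close> for the first \<open>n\<close> indices and
  \<^const>\<open>Inr\<close> for the last \<open>n\<close>.
\<close>

definition block_matrix ::
  "real^'n^'n \<Rightarrow> real^'n^'n \<Rightarrow> real^'n^'n \<Rightarrow> real^'n^'n \<Rightarrow> real^('n + 'n)^('n + 'n)" where
  "block_matrix P Q R T = (\<chi> i j.
     case i of
       Inl a \<Rightarrow> (case j of Inl b \<Rightarrow> P $ a $ b | Inr b \<Rightarrow> Q $ a $ b)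
     | Inr a \<Rightarrow> (case j of Inl b \<Rightarrow> R $ a $ b | Inr b \<Rightarrow> T $ a $ b))"

end

theory Submission
  imports Defs
begin

text \<open>
  The orthogonal change of coordinates \<open>(x, y) \<mapsto> (x + y, x - y) / sqrt 2\<close> block-diagonalises every matrix of the
  form \<open>[P, Q; Q, P]\<close>: it becomes \<open>diag (P + Q, P - Q)\<close>. Products and transposes are therefore
  computed on the two diagonal blocks, and so is the core-EP inverse; the only point to settle is that
  the three matrices may have different indices. This is harmless because the equations with any
  exponent \<open>k\<close> instead of the index already determine the solution.
\<close>

subsection \<open>Powers and index\<close>

lemma matrix_power_Suc_right: "matrix_power M (Suc k) = matrix_power M k ** M"
  by (induction k) (simp_all add: matrix_mul_assoc)

lemma matrix_power_add: "matrix_power M (j + k) = matrix_power M j ** matrix_power M k"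
  by (induction j) (simp_all add: matrix_mul_assoc)

text \<open>Makes the \<open>LEAST\<close> in \<open>matrix_index\<close> meaningful: otherwise the
  rank would drop by at least one at every step, which is impossible for natural numbers.\<close>

lemma rank_matrix_power_index:
  "rank (matrix_power M (matrix_index M + 1)) = rank (matrix_power M (matrix_index M))"
proof -
  have "\<exists>k. rank (matrix_power M (k + 1)) = rank (matrix_power M k)"
  proof (rule ccontr)
    assume "\<nexists>k. rank (matrix_power M (k + 1)) = rank (matrix_power M k)"
    then have less: "rank (matrix_power M (Suc k)) < rank (matrix_power M k)" for k
      using rank_mul_le_right[of M "matrix_power M k"] by (simp add: order_less_le)
    have "rank (matrix_power M k) + k \<le> rank (matrix_power M 0)" for k
    proof (induction k)
      case (Suc k)
      then show ?case using less[of k] by linarith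
    qed simp
    from this[of "Suc (rank (matrix_power M 0))"] show False by simp
  qed
  then show ?thesis
    unfolding matrix_index_def by (rule LeastI_ex)
qed

subsection \<open>Existence and uniqueness of the core-EP inverse\<close>

text \<open>Column \<open>j\<close> of \<open>C\<close> is a chosen preimage under \<open>A\<close>
  of column \<open>j\<close> of \<open>B\<close>.\<close>

lemma matrix_factor_through:
  fixes A :: "real^'n^'m" and B :: "real^'p^'m"
  assumes "range (\<lambda>x. B *v x) \<subseteq> range (\<lambda>x. A *v x)"
  shows "\<exists>C. B = A ** C"
proof -
  have "\<forall>j. \<exists>y. B *v axis j 1 = A *v y"
    using assms by blast
  then obtain c where c: "B *v axis j 1 = A *v c j" for j
    by metis
  have "column j B = column j (A ** (\<chi> i j. c j $ i))" for j
  proof -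
    have "(\<chi> i j. c j $ i) *v axis j 1 = c j"
      by (simp add: matrix_vector_mult_basis column_def)
    then have "(A ** (\<chi> i j. c j $ i)) *v axis j 1 = A *v c j"
      by (metis matrix_vector_mul_assoc)
    then show ?thesis
      using c[of j] by (simp add: matrix_vector_mult_basis)
  qed
  then have "B = A ** (\<chi> i j. c j $ i)"
    by (simp add: vec_eq_iff column_def)
  then show ?thesis ..
qed

text \<open>The range of \<open>A ** C\<close> lies in that of \<open>A\<close>; equal dimensions
  force the two ranges to coincide.\<close>

lemma matrix_factor_if_rank_eq:
  fixes A :: "real^'n^'m" and C :: "real^'p^'n"
  assumes "rank (A ** C) = rank A"
  shows "\<exists>F. A = (A ** C) ** F"
proof (rule matrix_factor_through)
  have "range (\<lambda>x. (A ** C) *v x) \<subseteq> range (\<lambda>x. A *v x)"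
    by (auto simp flip: matrix_vector_mul_assoc)
  moreover have "subspace (range (\<lambda>x. (A ** C) *v x))" "subspace (range (\<lambda>x. A *v x))"
    by (simp_all add: linear_subspace_image matrix_vector_mul_linear)
  ultimately have "range (\<lambda>x. (A ** C) *v x) = range (\<lambda>x. A *v x)"
    using assms by (intro subspace_dim_equal) (simp_all add: rank_dim_range)
  then show "range (\<lambda>x. A *v x) \<subseteq> range (\<lambda>x. (A ** C) *v x)"
    by simp
qed

text \<open>The columns of \<open>G\<close> solve the normal equations \<open>N\<^sup>T N g = N\<^sup>T e\<close>.\<close>

lemma ex_symmetric_inner_inverse:
  fixes N :: "real^'n^'m"
  shows "\<exists>G. N ** G ** N = N \<and> transpose (N ** G) = N ** G"
proof -
  \<comment> \<open>Solvability of the normal equations: the part of \<open>b\<close> orthogonal to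
    the range of \<open>N\<close> is killed by \<open>transpose N\<close>, so only the part
    \<open>N *v x\<close> contributes.\<close>
  have "range (\<lambda>x. transpose N *v x) \<subseteq> range (\<lambda>x. (transpose N ** N) *v x)"
  proof clarify
    fix b
    have span: "span (range (\<lambda>x. N *v x)) = range (\<lambda>x. N *v x)"
      unfolding span_eq_iff by (simp add: linear_subspace_image matrix_vector_mul_linear)
    obtain y z where "y \<in> span (range (\<lambda>x. N *v x))"
      and orth: "\<And>w. w \<in> span (range (\<lambda>x. N *v x)) \<Longrightarrow> orthogonal z w" and b: "b = y + z"
      using orthogonal_subspace_decomp_exists by blast
    then obtain x where y: "y = N *v x"
      unfolding span by blast
    have "(transpose N *v z) \<bullet> u = 0" for u
      using orth[of "N *v u"] by (simp add: span_base orthogonal_def dot_lmul_matrix)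
    then have "transpose N *v z = 0"
      using inner_eq_zero_iff by blast
    then have "transpose N *v b = (transpose N ** N) *v x"
      by (simp add: b y matrix_vector_right_distrib matrix_vector_mul_assoc)
    then show "transpose N *v b \<in> range (\<lambda>x. (transpose N ** N) *v x)"
      by blast
  qed
  then obtain G where "transpose N = (transpose N ** N) ** G"
    using matrix_factor_through by blast
  then have "transpose (transpose N) = transpose ((transpose N ** N) ** G)"
    by simp
  then have N: "N = transpose (N ** G) ** N"
    by (simp add: matrix_transpose_mul matrix_mul_assoc)
  \<comment> \<open>This writes \<open>N ** G\<close> as a Gram matrix, hence it is
    symmetric.\<close>
  then have NG: "N ** G = transpose (N ** G) ** (N ** G)"
    by (metis matrix_mul_assoc)
  then have "transpose (N ** G) = transpose (transpose (N ** G) ** (N ** G))"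
    by simp
  also have "\<dots> = transpose (N ** G) ** (N ** G)"
    by (simp only: matrix_transpose_mul[of "transpose (N ** G)"] transpose_transpose)
  finally have "transpose (N ** G) = N ** G"
    using NG by simp
  with N show ?thesis
    by metis
qed

text \<open>With k the index, the witness is \<open>M^k ** G\<close>, where \<open>G\<close> is a
  symmetric inner inverse of \<open>M^(k+1)\<close>. Stability of the rank lets \<open>M^k\<close>
  factor through \<open>M^(k+1)\<close> on either side, so that \<open>N ** G ** N = N\<close> can
  be applied.\<close>

lemma ex_core_ep_inverse: "\<exists>X. is_core_ep_inverse M X"
proof -
  define k P N where "k = matrix_index M" and "P = matrix_power M k" and "N = matrix_power M (Suc k)"
  have rank: "rank N = rank P"
    using rank_matrix_power_index[of M] by (simp add: N_def P_def k_def)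
  have NM: "N = M ** P" and NP: "N = P ** M"
    unfolding N_def P_def by (simp, rule matrix_power_Suc_right)
  obtain C where C: "P = N ** C"
    using matrix_factor_if_rank_eq[of P M] rank NP by auto
  \<comment> \<open>Passing to transposes compares row spaces instead of column spaces and yields
    the factorisation with \<open>N\<close> on the right.\<close>
  have "transpose N = transpose P ** transpose M"
    by (simp add: NM matrix_transpose_mul)
  then obtain F where "transpose P = transpose N ** F"
    using matrix_factor_if_rank_eq[of "transpose P" "transpose M"] rank
    by (metis rank_transpose)
  then have F: "P = transpose F ** N"
    by (metis matrix_transpose_mul transpose_transpose)
  obtain G where G: "N ** G ** N = N" "transpose (N ** G) = N ** G"
    using ex_symmetric_inner_inverse by blast
  have "(P ** G) ** N = transpose F ** (N ** G ** N)"
    unfolding F by (simp add: matrix_mul_assoc)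
  then have 1: "(P ** G) ** N = P"
    using G(1) F by simp
  have MX: "M ** (P ** G) = N ** G"
    by (simp add: NM matrix_mul_assoc)
  have "M ** ((P ** G) ** (P ** G)) = N ** G ** P ** G"
    by (simp add: NM matrix_mul_assoc)
  also have "N ** G ** P = P"
    unfolding C using G(1) by (simp add: matrix_mul_assoc)
  finally have "M ** ((P ** G) ** (P ** G)) = P ** G" .
  then have "is_core_ep_inverse M (P ** G)"
    using 1 MX G(2) by (simp add: is_core_ep_inverse_def N_def P_def k_def)
  then show ?thesis ..
qed

text \<open>The exponent is left free so that matrices of different index can be treated with one
  common exponent.\<close>

definition core_ep_equations :: "nat \<Rightarrow> real^'n^'n \<Rightarrow> real^'n^'n \<Rightarrow> bool" where
  "core_ep_equations k M X \<longleftrightarrow>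
     X ** matrix_power M (Suc k) = matrix_power M k \<and>
     M ** (X ** X) = X \<and>
     transpose (M ** X) = M ** X"

lemma is_core_ep_inverse_iff: "is_core_ep_inverse M X \<longleftrightarrow> core_ep_equations (matrix_index M) M X"
  by (simp add: is_core_ep_inverse_def core_ep_equations_def)

lemma core_ep_equations_mono:
  assumes "core_ep_equations k M X" "k \<le> l"
  shows "core_ep_equations l M X"
proof -
  obtain j where l: "l = k + j"
    using assms(2) le_Suc_ex by blast
  have "X ** matrix_power M (Suc k + j) = matrix_power M (k + j)"
    using assms(1) unfolding matrix_power_add core_ep_equations_def by (simp add: matrix_mul_assoc)
  then show ?thesis
    using assms(1) by (simp add: core_ep_equations_def l)
qed

text \<open>Both \<open>M X\<close> and \<open>M Y\<close> are the orthogonal projection onto the range of \<open>M\<^sup>k\<close>.\<close>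

lemma core_ep_equations_unique_aux:
  assumes X: "core_ep_equations k M X" and Y: "core_ep_equations k M Y"
  shows "X = Y"
proof -
  \<comment> \<open>Iterating \<open>V = M ** (V ** V)\<close> shows that the columns of
    \<open>V\<close> lie in the range of every power of \<open>M\<close>.\<close>
  have pow: "V = matrix_power M j ** matrix_power V (Suc j)"
    if "core_ep_equations k M V" for V j
  proof (induction j)
    case (Suc j)
    have V: "M ** (V ** V) = V"
      using that by (simp add: core_ep_equations_def)
    have "matrix_power M (Suc j) ** matrix_power V (Suc (Suc j))
        = matrix_power M j ** (M ** (V ** V)) ** matrix_power V j"
      by (simp add: matrix_power_Suc_right[of M] matrix_mul_assoc del: matrix_power.simps(2))
        (simp add: matrix_mul_assoc)
    also have "\<dots> = matrix_power M j ** matrix_power V (Suc j)"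
      by (simp only: V matrix_power.simps matrix_mul_assoc[symmetric])
    finally show ?case
      using Suc by simp
  qed simp
  \<comment> \<open>\<open>W ** M\<close> acts as the identity on the range of \<open>M^k\<close>,
    which contains the columns of \<open>V\<close>.\<close>
  have left: "W ** M ** V = V"
    if "core_ep_equations k M W" "core_ep_equations k M V" for W V
  proof -
    have "W ** M ** V = (W ** matrix_power M (Suc k)) ** matrix_power V (Suc k)"
      by (subst pow[OF that(2), of k]) (simp add: matrix_mul_assoc)
    also have "\<dots> = matrix_power M k ** matrix_power V (Suc k)"
      using that(1) by (simp add: core_ep_equations_def)
    also have "\<dots> = V"
      using pow[OF that(2), of k] by simp
    finally show ?thesis .
  qed
  have symX: "transpose (M ** X) = M ** X" and symY: "transpose (M ** Y) = M ** Y"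
    using X Y by (simp_all add: core_ep_equations_def)
  have "(M ** X) ** (M ** Y) = M ** (X ** M ** Y)" "(M ** Y) ** (M ** X) = M ** (Y ** M ** X)"
    by (simp_all add: matrix_mul_assoc)
  then have XY: "(M ** X) ** (M ** Y) = M ** Y" and YX: "(M ** Y) ** (M ** X) = M ** X"
    using left[OF X Y] left[OF Y X] by simp_all
  \<comment> \<open>By symmetry, transposing reverses the product, so
    \<open>(M ** X) ** (M ** Y)\<close> equals both \<open>M ** X\<close> and
    \<open>M ** Y\<close>.\<close>
  have "M ** X = transpose ((M ** Y) ** (M ** X))"
    using YX symX by simp
  also have "\<dots> = (M ** X) ** (M ** Y)"
    by (simp only: matrix_transpose_mul[of "M ** Y" "M ** X"] symX symY)
  finally have eq: "M ** X = M ** Y"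
    using XY by simp
  have "X = Y ** (M ** X)" "Y = Y ** (M ** Y)"
    using left[OF Y X] left[OF Y Y] by (simp_all add: matrix_mul_assoc)
  with eq show ?thesis
    by simp
qed

lemma core_ep_equations_unique:
  assumes "core_ep_equations k M X" "core_ep_equations l M Y"
  shows "X = Y"
  using assms core_ep_equations_mono[of _ M _ "max k l"] core_ep_equations_unique_aux
  by (metis max.cobounded1 max.cobounded2)

lemma core_ep_equations_core_ep_inverse:
  "core_ep_equations (matrix_index M) M (core_ep_inverse M)"
proof -
  have "\<exists>!X. is_core_ep_inverse M X"
    using ex_core_ep_inverse core_ep_equations_unique is_core_ep_inverse_iff by metis
  then show ?thesis
    unfolding core_ep_inverse_def is_core_ep_inverse_iff[symmetric] by (rule theI')
qed

lemma core_ep_inverse_eqI: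
  assumes "core_ep_equations k M X"
  shows "core_ep_inverse M = X"
  using core_ep_equations_unique[OF core_ep_equations_core_ep_inverse assms] .

subsection \<open>Block matrices with equal diagonal and equal off-diagonal blocks\<close>

text \<open>The matrix that becomes \<open>diag (P, Q)\<close> in the rotated coordinates; the
  arguments are the diagonalised blocks, not the visible ones.\<close>

definition sum_diff_block :: "real^'n^'n \<Rightarrow> real^'n^'n \<Rightarrow> real^('n + 'n)^('n + 'n)" where
  "sum_diff_block P Q = block_matrix
     ((1/2) *\<^sub>R (P + Q)) ((1/2) *\<^sub>R (P - Q)) ((1/2) *\<^sub>R (P - Q)) ((1/2) *\<^sub>R (P + Q))"

lemma block_matrix_eq_sum_diff_block: "block_matrix P Q Q P = sum_diff_block (P + Q) (P - Q)"
proof -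
  have "(1/2) *\<^sub>R (P + Q + (P - Q)) = P" "(1/2) *\<^sub>R (P + Q - (P - Q)) = Q"
    by (simp_all add: vec_eq_iff)
  then show ?thesis
    by (simp add: sum_diff_block_def)
qed

lemma block_matrix_inject:
  "block_matrix P Q R T = block_matrix P' Q' R' T' \<longleftrightarrow> P = P' \<and> Q = Q' \<and> R = R' \<and> T = T'"
  by (auto simp: block_matrix_def vec_eq_iff split: sum.splits)

lemma block_matrix_mult:
  fixes P Q R T P' Q' R' T' :: "real^'n^'n"
  shows "block_matrix P Q R T ** block_matrix P' Q' R' T' =
   block_matrix (P ** P' + Q ** R') (P ** Q' + Q ** T') (R ** P' + T ** R') (R ** Q' + T ** T')"
proof -
  have "sum f (UNIV :: ('n + 'n) set) = (\<Sum>a\<in>UNIV. f (Inl a)) + (\<Sum>a\<in>UNIV. f (Inr a))"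
    for f :: "'n + 'n \<Rightarrow> real"
    unfolding UNIV_sum by (subst sum.union_disjoint) (auto simp: sum.reindex)
  then show ?thesis
    by (simp add: block_matrix_def matrix_matrix_mult_def vec_eq_iff split: sum.split)
qed

text \<open>The mixed terms \<open>P ** Q'\<close> and \<open>Q ** P'\<close> cancel in each
  block.\<close>

lemma sum_diff_block_mult:
  "sum_diff_block P Q ** sum_diff_block P' Q' = sum_diff_block (P ** P') (Q ** Q')"
proof -
  have "((1/2) *\<^sub>R (P + Q)) ** ((1/2) *\<^sub>R (P' + Q')) + ((1/2) *\<^sub>R (P - Q)) ** ((1/2) *\<^sub>R (P' - Q'))
      = (1/2) *\<^sub>R (P ** P' + Q ** Q')"
    "((1/2) *\<^sub>R (P + Q)) ** ((1/2) *\<^sub>R (P' - Q')) + ((1/2) *\<^sub>R (P - Q)) ** ((1/2) *\<^sub>R (P' + Q'))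
      = (1/2) *\<^sub>R (P ** P' - Q ** Q')"
    by (simp_all add: vec_eq_iff matrix_matrix_mult_def sum_distrib_left
        flip: sum.distrib sum_subtractf) (auto intro!: sum.cong simp: field_simps)
  then show ?thesis
    by (simp add: sum_diff_block_def block_matrix_mult add.commute)
qed

lemma sum_diff_block_transpose:
  "transpose (sum_diff_block P Q) = sum_diff_block (transpose P) (transpose Q)"
  by (simp add: sum_diff_block_def block_matrix_def transpose_def vec_eq_iff split: sum.split)

lemma sum_diff_block_power:
  "matrix_power (sum_diff_block P Q) k = sum_diff_block (matrix_power P k) (matrix_power Q k)"
proof (induction k)
  case 0
  show ?case
    by (simp add: sum_diff_block_def block_matrix_def mat_def vec_eq_iff split: sum.split)
qed (simp add: sum_diff_block_mult)

lemma core_ep_inverse_sum_diff_block: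
  "core_ep_inverse (sum_diff_block P Q) = sum_diff_block (core_ep_inverse P) (core_ep_inverse Q)"
proof (rule core_ep_inverse_eqI)
  \<comment> \<open>An exponent valid for both blocks at once; the index of the block matrix itself
    need not be computed.\<close>
  let ?k = "max (matrix_index P) (matrix_index Q)"
  have "core_ep_equations ?k P (core_ep_inverse P)" "core_ep_equations ?k Q (core_ep_inverse Q)"
    by (rule core_ep_equations_mono[OF core_ep_equations_core_ep_inverse], simp)+
  then show "core_ep_equations ?k (sum_diff_block P Q)
      (sum_diff_block (core_ep_inverse P) (core_ep_inverse Q))"
    unfolding core_ep_equations_def
    by (simp only: sum_diff_block_power sum_diff_block_mult sum_diff_block_transpose)
qed

theorem theorem3p2:
  fixes A D E H Z :: "real^'n^'n"
    and S :: "real^('n + 'n)^('n + 'n)"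
  assumes "D = (\<chi> i j. max (A $ i $ j) 0)"
    and "E = (\<chi> i j. max (- (A $ i $ j)) 0)"
    and "S = block_matrix D E E D"
  shows "core_ep_inverse S = block_matrix H Z Z H \<longleftrightarrow>
    H = (1/2) *\<^sub>R (core_ep_inverse (D + E) + core_ep_inverse (D - E)) \<and>
    Z = (1/2) *\<^sub>R (core_ep_inverse (D + E) - core_ep_inverse (D - E))"
proof -
  have "core_ep_inverse S = sum_diff_block (core_ep_inverse (D + E)) (core_ep_inverse (D - E))"
    by (simp only: assms(3) block_matrix_eq_sum_diff_block core_ep_inverse_sum_diff_block)
  \<comment> \<open>Comparing the blocks of the two matrices reads off \<open>H\<close> and
    \<open>Z\<close>.\<close>
  then show ?thesis
    by (auto simp: sum_diff_block_def block_matrix_inject)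
qed

end
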